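(* Let $\mathcal{M}=(E,\mathcal{T})$ be a simple oriented matroid that is not acyclic, on ground set $E$, with set of topes $\mathcal{T}$. Let $\mathbf{K}_3^{\ast}(\mathcal{M})$ be the family of all tope committees of cardinality three for $\mathcal{M}$, let $\mathbf{max}^+(\mathcal{T})$ be the set of topes of $\mathcal{M}$ whose positive parts are inclusion-maximal, and let $\widehat{L}$ be the lattice of convex subsets of $E$ augmented by the greatest element $\hat{1}:=E$. Then the number of committees of cardinality three for $\mathcal{M}$ whose topes have inclusion-maximal positive parts is $$\#\{\mathcal{K}^{\ast}\in\mathbf{K}_3^{\ast}(\mathcal{M}):\ \mathcal{K}^{\ast}\subseteq\mathbf{max}^+(\mathcal{T})\}=\frac{1}{3}\sum_{\substack{\{D_1,D_2\}\subset\widehat{L}:\\ \{E-D_1,E-D_2\}\subset\widehat{L}^{\mathrm{c}},\\ D_1\wedge D_2=\hat{0}}}\bigl|[D_1\vee D_2,\hat{1}]^{\mathrm{c}}\bigr|,$$ where the sum is over unordered pairs (2-element subsets) $\{D_1,D_2\}$.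
   Context: An oriented matroid is called simple here if it has no loops, no parallel elements and no antiparallel elements. Topes are the maximal covectors, regarded as sign vectors $T\in\{+,-\}^E$. $\mathcal{M}$ is acyclic if it has the tope all of whose components are $+$. For a sign vector $F$, $F^+$ denotes its positive part $\{e\in E: F(e)=+\}$. For $e\in E$, the positive halfspace is $\mathcal{T}_e^+:=\{T\in\mathcal{T}: T(e)=+\}$. A tope committee for $\mathcal{M}$ is a subset $\mathcal{K}^{\ast}\subset\mathcal{T}$ such that $|\mathcal{T}_e^+\cap\mathcal{K}^{\ast}|>\frac12|\mathcal{K}^{\ast}|$ for every $e\in E$. The set $\mathbf{max}^+(\mathcal{T})$ consists of the topes $T\in\mathcal{T}$ such that $T^+$ is maximal with respect to inclusion among the positive parts of topes of $\mathcal{M}$. The symbol $\#$ denotes the number of sets in a family. A subset $A\subset E$ is acyclic if the restriction of $\mathcal{M}$ to $A$ is an acyclic oriented matroid. The convex hull $\mathrm{conv}(A)$ of an acyclic set $A$ is the set of all $b\in E$ such that for every covector $F$ of $\mathcal{M}$, if $F(a)=+$ for all $a\in A$ then $F(b)=+$. An acyclic set $A$ is convex if $\mathrm{conv}(A)=A$. The convex subsets of $E$ ordered by inclusion form a meet-semilattice with least element $\hat{0}$ the empty set; $\widehat{L}$ is this poset with a greatest element $\hat{1}:=E$ adjoined. It is a lattice, with meet $\wedge$ and join $\vee$. For a bounded poset $P$, $P^{\mathrm{c}}$ denotes its set of coatoms (elements covered by the greatest element of $P$). A one-element poset has no coatoms, and for a two-element chain $x<y$ one has $\{x,y\}^{\mathrm{c}}=\{x\}$.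 For $x\le z$ in $P$, $[x,z]:=\{y\in P: x\le y\le z\}$ is the closed interval, so $[x,\hat{1}]^{\mathrm{c}}$ is the set of coatoms of the interval $[x,\hat{1}]$ regarded as a bounded poset. *)

theory Defs
  imports Complex_Main "HOL-Algebra.Lattice"
begin

datatype sign = Neg | Zero | Pos

fun sign_neg :: "sign \<Rightarrow> sign" where
  "sign_neg Neg = Pos"
| "sign_neg Zero = Zero"
| "sign_neg Pos = Neg"

(* A sign vector on E is a function that is Zero outside E; in this way sign vectors on E are
   determined by their entries on E, and families of them can be counted. *)
type_synonym 'a sign_vec = "'a \<Rightarrow> sign"

definition sign_vecs :: "'a set \<Rightarrow> 'a sign_vec set" where
  "sign_vecs E = {X. \<forall>e. e \<notin> E \<longrightarrow> X e = Zero}"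

definition vec_neg :: "'a sign_vec \<Rightarrow> 'a sign_vec" where
  "vec_neg X = (\<lambda>e. sign_neg (X e))"

definition vec_comp :: "'a sign_vec \<Rightarrow> 'a sign_vec \<Rightarrow> 'a sign_vec" where
  "vec_comp X Y = (\<lambda>e. if X e \<noteq> Zero then X e else Y e)"

definition separation :: "'a sign_vec \<Rightarrow> 'a sign_vec \<Rightarrow> 'a set" where
  "separation X Y = {e. X e \<noteq> Zero \<and> Y e = sign_neg (X e)}"

definition pos_part :: "'a sign_vec \<Rightarrow> 'a set" where
  "pos_part X = {e. X e = Pos}"

(* Covector axioms; an oriented matroid is given by its finite ground set E and its set L of
   covectors. *)
locale oriented_matroid =
  fixes E :: "'a set" and L :: "'a sign_vec set"
  assumes finite_ground: "finite E"
    and covectors_on_ground: "L \<subseteq> sign_vecs E"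
    and zero_covector: "(\<lambda>_. Zero) \<in> L"
    and neg_covector: "X \<in> L \<Longrightarrow> vec_neg X \<in> L"
    and comp_covector: "\<lbrakk>X \<in> L; Y \<in> L\<rbrakk> \<Longrightarrow> vec_comp X Y \<in> L"
    and elimination: "\<lbrakk>X \<in> L; Y \<in> L; e \<in> separation X Y\<rbrakk> \<Longrightarrow>
      \<exists>Z\<in>L. Z e = Zero \<and> (\<forall>f\<in>E - separation X Y. Z f = vec_comp X Y f)"

definition is_loop :: "'a sign_vec set \<Rightarrow> 'a \<Rightarrow> bool" where
  "is_loop L e \<longleftrightarrow> (\<forall>X\<in>L. X e = Zero)"

definition parallel :: "'a sign_vec set \<Rightarrow> 'a \<Rightarrow> 'a \<Rightarrow> bool" where
  "parallel L e f \<longleftrightarrow> e \<noteq> f \<and> (\<forall>X\<in>L. X e = X f)"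

definition antiparallel :: "'a sign_vec set \<Rightarrow> 'a \<Rightarrow> 'a \<Rightarrow> bool" where
  "antiparallel L e f \<longleftrightarrow> e \<noteq> f \<and> (\<forall>X\<in>L. X e = sign_neg (X f))"

definition om_simple :: "'a set \<Rightarrow> 'a sign_vec set \<Rightarrow> bool" where
  "om_simple E L \<longleftrightarrow> (\<forall>e\<in>E. \<not> is_loop L e) \<and>
     (\<forall>e\<in>E. \<forall>f\<in>E. \<not> parallel L e f \<and> \<not> antiparallel L e f)"

(* The conformal order on sign vectors: componentwise, with Zero below both Neg and Pos, which
   are incomparable. *)
definition vec_le :: "'a sign_vec \<Rightarrow> 'a sign_vec \<Rightarrow> bool" where
  "vec_le X Y \<longleftrightarrow> (\<forall>e. X e = Zero \<or> X e = Y e)"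

definition topes :: "'a sign_vec set \<Rightarrow> 'a sign_vec set" where
  "topes L = {T \<in> L. \<forall>X\<in>L. vec_le T X \<longrightarrow> X = T}"

definition om_acyclic :: "'a set \<Rightarrow> 'a sign_vec set \<Rightarrow> bool" where
  "om_acyclic E L \<longleftrightarrow> (\<exists>T\<in>topes L. \<forall>e\<in>E. T e = Pos)"

definition om_restrict :: "'a sign_vec set \<Rightarrow> 'a set \<Rightarrow> 'a sign_vec set" where
  "om_restrict L A = (\<lambda>X e. if e \<in> A then X e else Zero) ` L"

definition acyclic_subset :: "'a set \<Rightarrow> 'a sign_vec set \<Rightarrow> 'a set \<Rightarrow> bool" where
  "acyclic_subset E L A \<longleftrightarrow> A \<subseteq> E \<and> om_acyclic A (om_restrict L A)"

definition om_conv :: "'a set \<Rightarrow> 'a sign_vec set \<Rightarrow> 'a set \<Rightarrow> 'a set" where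
  "om_conv E L A = {b \<in> E. \<forall>F\<in>L. (\<forall>a\<in>A. F a = Pos) \<longrightarrow> F b = Pos}"

definition om_convex :: "'a set \<Rightarrow> 'a sign_vec set \<Rightarrow> 'a set \<Rightarrow> bool" where
  "om_convex E L A \<longleftrightarrow> acyclic_subset E L A \<and> om_conv E L A = A"

definition pos_halfspace :: "'a sign_vec set \<Rightarrow> 'a \<Rightarrow> 'a sign_vec set" where
  "pos_halfspace L e = {T \<in> topes L. T e = Pos}"

definition tope_committee :: "'a set \<Rightarrow> 'a sign_vec set \<Rightarrow> 'a sign_vec set \<Rightarrow> bool" where
  "tope_committee E L K \<longleftrightarrow> K \<subseteq> topes L \<and>
     (\<forall>e\<in>E. real (card (pos_halfspace L e \<inter> K)) > 1 / 2 * real (card K))"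

definition committees3 :: "'a set \<Rightarrow> 'a sign_vec set \<Rightarrow> 'a sign_vec set set" where
  "committees3 E L = {K. tope_committee E L K \<and> card K = 3}"

definition max_pos_topes :: "'a sign_vec set \<Rightarrow> 'a sign_vec set" where
  "max_pos_topes L = {T \<in> topes L. \<not> (\<exists>T'\<in>topes L. pos_part T \<subset> pos_part T')}"

definition convex_lattice :: "'a set \<Rightarrow> 'a sign_vec set \<Rightarrow> 'a set gorder" where
  "convex_lattice E L =
     \<lparr>carrier = insert E {A. om_convex E L A}, eq = (=), le = (\<subseteq>)\<rparr>"

definition covered_by :: "('b, 'c) gorder_scheme \<Rightarrow> 'b \<Rightarrow> 'b \<Rightarrow> bool" where
  "covered_by P x y \<longleftrightarrow> x \<in> carrier P \<and> y \<in> carrier P \<and> x \<sqsubset>\<^bsub>P\<^esub> y \<and>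
     \<not> (\<exists>z\<in>carrier P. x \<sqsubset>\<^bsub>P\<^esub> z \<and> z \<sqsubset>\<^bsub>P\<^esub> y)"

definition coatoms :: "('b, 'c) gorder_scheme \<Rightarrow> 'b set" where
  "coatoms P = {x. covered_by P x \<top>\<^bsub>P\<^esub>}"

definition interval_poset :: "('b, 'c) gorder_scheme \<Rightarrow> 'b \<Rightarrow> 'b \<Rightarrow> ('b, 'c) gorder_scheme" where
  "interval_poset P x z = P\<lparr>carrier := \<lbrace>x..z\<rbrace>\<^bsub>P\<^esub>\<rparr>"

(* The unordered pairs indexing the sum. For such a pair D = {D1, D2} the join of D1 and D2 is,
   by definition of join, the supremum of D. *)
definition coatom_pairs :: "'a set \<Rightarrow> 'a sign_vec set \<Rightarrow> 'a set set set" where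
  "coatom_pairs E L = {{D1, D2} | D1 D2.
     D1 \<in> carrier (convex_lattice E L) \<and> D2 \<in> carrier (convex_lattice E L) \<and> D1 \<noteq> D2 \<and>
     {E - D1, E - D2} \<subseteq> coatoms (convex_lattice E L) \<and>
     D1 \<sqinter>\<^bsub>convex_lattice E L\<^esub> D2 = \<bottom>\<^bsub>convex_lattice E L\<^esub>}"

context oriented_matroid
begin

lemma acyclic_subset_iff:
  "acyclic_subset E L A \<longleftrightarrow> A \<subseteq> E \<and> (\<exists>F\<in>L. \<forall>a\<in>A. F a = Pos)"
proof
  assume asm: "acyclic_subset E L A"
  then obtain T where T: "T \<in> om_restrict L A" "\<forall>e\<in>A. T e = Pos"
    unfolding acyclic_subset_def om_acyclic_def topes_def by blast
  then obtain F where "F \<in> L" "T = (\<lambda>e. if e \<in> A then F e else Zero)"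
    unfolding om_restrict_def by blast
  then have "F \<in> L" "\<forall>a\<in>A. F a = Pos" using T(2) by auto
  then show "A \<subseteq> E \<and> (\<exists>F\<in>L. \<forall>a\<in>A. F a = Pos)"
    using asm unfolding acyclic_subset_def by blast
next
  assume asm: "A \<subseteq> E \<and> (\<exists>F\<in>L. \<forall>a\<in>A. F a = Pos)"
  then obtain F where F: "F \<in> L" "\<forall>a\<in>A. F a = Pos" by blast
  let ?T = "\<lambda>e. if e \<in> A then F e else Zero"
  have "X = ?T" if X: "X \<in> om_restrict L A" "vec_le ?T X" for X
  proof
    fix e
    show "X e = ?T e"
    proof (cases "e \<in> A")
      case True
      then show ?thesis using X(2) F(2) by (auto simp: vec_le_def dest!: spec[of _ e])
    next
      case False
      then show ?thesis using X(1) by (auto simp: om_restrict_def)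
    qed
  qed
  moreover have "?T \<in> om_restrict L A"
    using F(1) unfolding om_restrict_def by blast
  ultimately have "?T \<in> topes (om_restrict L A)"
    unfolding topes_def by blast
  then show "acyclic_subset E L A"
    unfolding acyclic_subset_def om_acyclic_def using asm F(2) by (auto intro!: bexI[of _ ?T])
qed

lemma convex_empty: "om_convex E L {}"
  using zero_covector
  by (auto simp: om_convex_def acyclic_subset_iff om_conv_def)

lemma convex_Int:
  assumes "om_convex E L A" "om_convex E L B"
  shows "om_convex E L (A \<inter> B)"
proof -
  have "acyclic_subset E L (A \<inter> B)"
    using assms(1) by (auto simp: om_convex_def acyclic_subset_iff)
  moreover have "om_conv E L (A \<inter> B) \<subseteq> om_conv E L A" "om_conv E L (A \<inter> B) \<subseteq> om_conv E L B"
    by (auto simp: om_conv_def)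
  moreover have "A \<inter> B \<subseteq> om_conv E L (A \<inter> B)"
    using assms(1) by (auto simp: om_convex_def acyclic_subset_iff om_conv_def)
  ultimately show ?thesis
    using assms unfolding om_convex_def by (simp add: subset_antisym)
qed

lemma convex_conv:
  assumes "acyclic_subset E L A"
  shows "om_convex E L (om_conv E L A)" "A \<subseteq> om_conv E L A"
proof -
  obtain F where F: "A \<subseteq> E" "F \<in> L" "\<forall>a\<in>A. F a = Pos"
    using assms by (auto simp: acyclic_subset_iff)
  show sub: "A \<subseteq> om_conv E L A"
    using F(1) by (auto simp: om_conv_def)
  have "\<forall>b\<in>om_conv E L A. F b = Pos" "om_conv E L A \<subseteq> E"
    using F by (simp_all add: om_conv_def)
  then have "acyclic_subset E L (om_conv E L A)"
    using F(2) unfolding acyclic_subset_iff by blast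
  moreover have "om_conv E L (om_conv E L A) = om_conv E L A"
  proof (rule antisym)
    show "om_conv E L (om_conv E L A) \<subseteq> om_conv E L A"
    proof
      fix b
      assume b: "b \<in> om_conv E L (om_conv E L A)"
      have "G b = Pos" if "G \<in> L" "\<forall>a\<in>A. G a = Pos" for G
        using b that by (simp add: om_conv_def)
      then show "b \<in> om_conv E L A"
        using b by (simp add: om_conv_def)
    qed
    show "om_conv E L A \<subseteq> om_conv E L (om_conv E L A)"
      by (auto simp: om_conv_def)
  qed
  ultimately show "om_convex E L (om_conv E L A)"
    by (simp add: om_convex_def)
qed

(* The poset is a lattice, so the library's choice-based top, bottom, join and meet denote
   the intended elements. *)
lemma bounded_lattice_convex_lattice: "bounded_lattice (convex_lattice E L)"
proof -
  let ?P = "convex_lattice E L"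
  have sub: "A \<subseteq> E" if "A \<in> carrier ?P" for A
    using that by (auto simp: convex_lattice_def om_convex_def acyclic_subset_def)
  have le: "x \<sqsubseteq>\<^bsub>?P\<^esub> y \<longleftrightarrow> x \<subseteq> y" for x y
    by (simp add: convex_lattice_def)
  have lubI: "least ?P S (Upper ?P {A, B})"
    if "S \<in> carrier ?P" "A \<subseteq> S" "B \<subseteq> S"
      "A \<in> carrier ?P" "B \<in> carrier ?P"
      "\<And>C. \<lbrakk>C \<in> carrier ?P; A \<subseteq> C; B \<subseteq> C\<rbrakk> \<Longrightarrow> S \<subseteq> C" for S A B
  proof -
    have "Upper ?P {A, B} = {C \<in> carrier ?P. A \<subseteq> C \<and> B \<subseteq> C}"
      using that(4,5) by (auto simp: Upper_def le)
    then show ?thesis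
      using that(1-3,6) by (simp add: least_def le)
  qed
  interpret partial_order ?P
    by unfold_locales (auto simp: convex_lattice_def)
  have glb: "greatest ?P (A \<inter> B) (Lower ?P {A, B})"
    if "A \<in> carrier ?P" "B \<in> carrier ?P" for A B
  proof -
    have "A \<inter> B \<in> carrier ?P"
      using that sub[OF that(1)] sub[OF that(2)]
      by (auto simp: convex_lattice_def intro: convex_Int simp: Int_absorb1 Int_absorb2)
    then show ?thesis
      using that by (auto simp: greatest_def Lower_def convex_lattice_def)
  qed
  have lub: "\<exists>s. least ?P s (Upper ?P {A, B})"
    if AB: "A \<in> carrier ?P" "B \<in> carrier ?P" for A B
  proof (cases "acyclic_subset E L (A \<union> B)")
    case True
    have "om_conv E L (A \<union> B) \<subseteq> C" if "C \<in> carrier ?P" "A \<subseteq> C" "B \<subseteq> C" for C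
    proof (cases "C = E")
      case True
      then show ?thesis by (auto simp: om_conv_def)
    next
      case False
      then have "om_conv E L C = C"
        using that(1) by (simp add: convex_lattice_def om_convex_def)
      moreover have "om_conv E L (A \<union> B) \<subseteq> om_conv E L C"
        using that(2,3) unfolding om_conv_def by blast
      ultimately show ?thesis by simp
    qed
    then have "least ?P (om_conv E L (A \<union> B)) (Upper ?P {A, B})"
      using convex_conv[OF True] AB by (intro lubI) (auto simp: convex_lattice_def)
    then show ?thesis ..
  next
    case False
    have "C = E" if "C \<in> carrier ?P" "A \<subseteq> C" "B \<subseteq> C" for C
    proof (rule ccontr)
      assume "C \<noteq> E"
      then have "acyclic_subset E L C"
        using that(1) by (simp add: convex_lattice_def om_convex_def)
      then have "acyclic_subset E L (A \<union> B)"
        using that(2,3) unfolding acyclic_subset_iff by blast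
      then show False using False by contradiction
    qed
    then have "least ?P E (Upper ?P {A, B})"
      using AB by (intro lubI sub) (auto simp: convex_lattice_def)
    then show ?thesis ..
  qed
  show ?thesis
  proof unfold_locales
    show "\<exists>x. least ?P x (carrier ?P)"
      using convex_empty by (auto simp: least_def convex_lattice_def)
    show "\<exists>x. greatest ?P x (carrier ?P)"
      using sub by (auto simp: greatest_def convex_lattice_def)
  qed (use glb lub in blast)+
qed

lemma convex_lattice_top: "\<top>\<^bsub>convex_lattice E L\<^esub> = E"
  by (rule bounded_lattice.top_eq[OF bounded_lattice_convex_lattice, symmetric])
     (auto simp: convex_lattice_def om_convex_def acyclic_subset_def)

lemma convex_lattice_bottom: "\<bottom>\<^bsub>convex_lattice E L\<^esub> = {}"
  by (rule bounded_lattice.bottom_eq[OF bounded_lattice_convex_lattice, symmetric])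
     (use convex_empty in \<open>auto simp: convex_lattice_def\<close>)

end

end

theory Submission
  imports Defs
begin

text \<open>The coatoms of the lattice of convex sets are exactly the positive parts of the topes with
  inclusion-maximal positive part, and such a tope is determined by its negative part. Three topes
  form a committee iff no element is negative in two of them, that is, iff their negative parts are
  pairwise disjoint. Counting the pairs (triple of disjoint negative parts, two-element subset of it)
  by their second component gives the sum, and each triple has three such subsets; the third member
  of a triple over \<open>{D1, D2}\<close> is the complement of a coatom containing \<open>D1 \<union> D2\<close>.\<close>

section \<open>Double counting of pairwise disjoint subfamilies of a finite family\<close>

definition disjoint_subfamilies :: "'a set set \<Rightarrow> nat \<Rightarrow> 'a set set set" where
  "disjoint_subfamilies N k = {S. S \<subseteq> N \<and> card S = k \<and> pairwise disjnt S}"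

lemma finite_disjoint_subfamilies: "finite N \<Longrightarrow> finite (disjoint_subfamilies N k)"
  by (rule finite_subset[of _ "Pow N"]) (auto simp: disjoint_subfamilies_def)

text \<open>Pairwise disjointness passes to subfamilies, so each \<open>S\<close> of size
  \<open>k\<close> is counted once for each of its \<open>k choose j\<close> subsets of size
  \<open>j\<close>. Counting the pairs \<open>D\<close> \<subseteq> \<open>S\<close> by
  \<open>S\<close> instead of by \<open>D\<close> gives the product.\<close>

lemma sum_extensions_disjoint_subfamilies:
  assumes "finite N"
  shows "(\<Sum>D\<in>disjoint_subfamilies N j. card {S \<in> disjoint_subfamilies N k. D \<subseteq> S}) =
    (k choose j) * card (disjoint_subfamilies N k)"
proof (rule sum_multicount[OF finite_disjoint_subfamilies finite_disjoint_subfamilies], safe)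
  fix S assume S: "S \<in> disjoint_subfamilies N k"
  then have "finite S"
    using assms finite_subset by (auto simp: disjoint_subfamilies_def)
  moreover have "{D \<in> disjoint_subfamilies N j. D \<subseteq> S} = {D. D \<subseteq> S \<and> card D = j}"
    using S by (auto simp: disjoint_subfamilies_def intro: pairwise_subset[of disjnt S])
  ultimately show "card {D \<in> disjoint_subfamilies N j. D \<subseteq> S} = k choose j"
    using S n_subsets[of S j] by (simp add: disjoint_subfamilies_def)
qed (use assms in auto)

text \<open>An extension of \<open>D\<close> by one set amounts to the choice of the added set
  \<open>A\<close>, through the bijection from \<open>A\<close> to
  \<open>insert A D\<close>.\<close>

lemma card_one_step_extensions:
  assumes D: "D \<in> disjoint_subfamilies N k" and fin: "finite N" and ne: "{} \<notin> N"
  shows "card {S \<in> disjoint_subfamilies N (Suc k). D \<subseteq> S} = card {A \<in> N. \<forall>B\<in>D. disjnt A B}"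
proof -
  have D': "D \<subseteq> N" "card D = k" "pairwise disjnt D" "finite D"
    using D fin finite_subset by (auto simp: disjoint_subfamilies_def)
  \<comment> \<open>A member of \<open>D\<close> that is disjoint from all of \<open>D\<close> is
    disjoint from itself, hence empty. Excluding the empty set from \<open>N\<close> ensures that
    inserting \<open>A\<close> really raises the cardinality.\<close>
  have new: "A \<notin> D" if "A \<in> N" "\<forall>B\<in>D. disjnt A B" for A
    using that ne by (metis disjnt_self_iff_empty)
  have "bij_betw (\<lambda>A. insert A D) {A \<in> N. \<forall>B\<in>D. disjnt A B}
    {S \<in> disjoint_subfamilies N (Suc k). D \<subseteq> S}"
  proof (rule bij_betwI')
    fix A A' assume "A \<in> {A \<in> N. \<forall>B\<in>D. disjnt A B}" "A' \<in> {A \<in> N. \<forall>B\<in>D. disjnt A B}"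
    then have "A \<notin> D" "A' \<notin> D"
      using new by auto
    then show "insert A D = insert A' D \<longleftrightarrow> A = A'"
      by (metis insertE insertI1)
  next
    fix A assume "A \<in> {A \<in> N. \<forall>B\<in>D. disjnt A B}"
    then have A: "A \<in> N" "\<forall>B\<in>D. disjnt A B" by auto
    then have "card (insert A D) = Suc k" "pairwise disjnt (insert A D)"
      using new[of A] D' by (auto simp: pairwise_insert disjnt_sym[of A])
    then show "insert A D \<in> {S \<in> disjoint_subfamilies N (Suc k). D \<subseteq> S}"
      using A(1) D'(1) by (simp add: disjoint_subfamilies_def subset_insertI)
  next
    fix S assume "S \<in> {S \<in> disjoint_subfamilies N (Suc k). D \<subseteq> S}"
    then have S: "S \<subseteq> N" "card S = Suc k" "pairwise disjnt S" "D \<subseteq> S"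
      by (auto simp: disjoint_subfamilies_def)
    have "card (S - D) = 1"
      using card_Diff_subset[OF D'(4) S(4)] S(2) D'(2) by simp
    then obtain A where A: "S - D = {A}"
      by (auto simp: card_1_singleton_iff)
    then have "S = insert A D" "A \<in> S" "A \<notin> D"
      using S(4) by auto
    moreover from this have "\<forall>B\<in>D. disjnt A B"
      using S(3,4) by (metis pairwiseD subsetD)
    ultimately show "\<exists>A\<in>{A \<in> N. \<forall>B\<in>D. disjnt A B}. S = insert A D"
      using S(1) by auto
  qed
  then show ?thesis
    by (simp add: bij_betw_same_card)
qed

lemma vec_le_pos_part: "vec_le X Y \<Longrightarrow> pos_part X \<subseteq> pos_part Y"
  by (auto simp: vec_le_def pos_part_def) (metis sign.distinct(6))

section \<open>Topes and convex sets in an arbitrary oriented matroid\<close>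

context oriented_matroid
begin

lemma finite_covectors: "finite L"
proof -
  have "(UNIV :: sign set) = {Neg, Zero, Pos}"
    using sign.exhaust by blast
  then have "finite (UNIV :: sign set)"
    by (metis finite.emptyI finite.insertI)
  then have "finite (sign_vecs E)"
    using finite_set_of_finite_funs[OF finite_ground, of UNIV Zero] by (simp add: sign_vecs_def)
  then show ?thesis
    using covectors_on_ground finite_subset by blast
qed

lemma covector_outside: "\<lbrakk>X \<in> L; e \<notin> E\<rbrakk> \<Longrightarrow> X e = Zero"
  using covectors_on_ground by (auto simp: sign_vecs_def)

lemma pos_part_subset: "X \<in> L \<Longrightarrow> pos_part X \<subseteq> E"
  using covector_outside by (force simp: pos_part_def)

lemma tope_covector: "T \<in> topes L \<Longrightarrow> T \<in> L"
  by (simp add: topes_def)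

text \<open>Among the covectors above \<open>F\<close>, one with support of largest size is a tope:
  a covector above it has the same support, and conformal vectors with equal support
  coincide.\<close>

lemma covector_le_tope:
  assumes "F \<in> L"
  obtains T where "T \<in> topes L" "vec_le F T"
proof -
  let ?supp = "\<lambda>X. {e \<in> E. X e \<noteq> Zero}"
  let ?P = "\<lambda>X. X \<in> L \<and> vec_le F X"
  have "\<exists>T. ?P T \<and> (\<forall>Y. ?P Y \<longrightarrow> card (?supp Y) \<le> card (?supp T))"
    \<comment> \<open>The upper bound on the measure has to be strict, hence
      \<open>Suc (card E)\<close>.\<close>
    by (rule ex_has_greatest_nat[of ?P F _ "Suc (card E)"])
      (use assms finite_ground in \<open>auto simp: vec_le_def simp: less_Suc_eq_le intro!: card_mono\<close>)
  then obtain T where T: "T \<in> L" "vec_le F T"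
    and max: "\<And>Y. \<lbrakk>Y \<in> L; vec_le F Y\<rbrakk> \<Longrightarrow> card (?supp Y) \<le> card (?supp T)"
    by blast
  have "X = T" if X: "X \<in> L" "vec_le T X" for X
  proof -
    have "vec_le F X"
      using T(2) X(2) by (auto simp: vec_le_def) (metis)
    then have "card (?supp X) \<le> card (?supp T)"
      using max X(1) by blast
    moreover have "?supp T \<subseteq> ?supp X"
      using X(2) by (auto simp: vec_le_def)
    ultimately have eq: "?supp T = ?supp X"
      using finite_ground by (intro card_seteq) auto
    show "X = T"
    proof
      fix e
      show "X e = T e"
      proof (cases "e \<in> E \<and> T e \<noteq> Zero")
        case True
        then show ?thesis using X(2) by (auto simp: vec_le_def)
      next
        case False
        then have "X e = Zero" "T e = Zero"
          using eq covector_outside X(1) T(1) by blast+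
        then show ?thesis by simp
      qed
    qed
  qed
  then have "T \<in> topes L"
    using T(1) by (auto simp: topes_def)
  with T(2) that show thesis by blast
qed

text \<open>The tope \<open>T\<close> itself is the witness twice: it shows that its positive part
  is acyclic, and, being one of the covectors tested in \<open>om_conv\<close>, it keeps the hull
  inside that positive part.\<close>

lemma tope_pos_part_convex:
  assumes "T \<in> topes L"
  shows "om_convex E L (pos_part T)"
  using assms pos_part_subset[of T]
  by (auto simp: om_convex_def acyclic_subset_iff om_conv_def topes_def pos_part_def)

lemma convex_subset_tope:
  assumes "om_convex E L A"
  obtains T where "T \<in> topes L" "A \<subseteq> pos_part T"
proof -
  obtain F where "F \<in> L" "A \<subseteq> pos_part F"
    using assms by (auto simp: om_convex_def acyclic_subset_iff pos_part_def)
  then show thesis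
    using covector_le_tope vec_le_pos_part that by (metis subset_trans)
qed

lemma tope_subset_max_pos_tope:
  assumes "T \<in> topes L"
  obtains T' where "T' \<in> max_pos_topes L" "pos_part T \<subseteq> pos_part T'"
proof -
  have "finite (pos_part ` topes L)"
    using finite_covectors by (auto simp: topes_def)
  then obtain A where "A \<in> pos_part ` topes L" "pos_part T \<subseteq> A"
    "\<forall>B\<in>pos_part ` topes L. A \<subseteq> B \<longrightarrow> A = B"
    using finite_has_maximal2 assms by (metis imageI)
  then show thesis
    using that by (auto simp: max_pos_topes_def psubset_eq)
qed

text \<open>Once \<open>x\<close> \<subseteq> \<open>C\<close>, everything strictly between
  \<open>C\<close> and \<open>E\<close> lies in the interval, so covering by \<open>E\<close> means
  the same in both posets. For \<open>x = E\<close> both sides are empty.\<close>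

lemma coatoms_interval:
  assumes "x \<in> carrier (convex_lattice E L)"
  shows "coatoms (interval_poset (convex_lattice E L) x (\<top>\<^bsub>convex_lattice E L\<^esub>)) =
    {C \<in> coatoms (convex_lattice E L). x \<subseteq> C}"
proof -
  let ?P = "convex_lattice E L"
  let ?I = "interval_poset ?P x E"
  have sub: "A \<subseteq> E" if "A \<in> carrier ?P" for A
    using that by (auto simp: convex_lattice_def om_convex_def acyclic_subset_def)
  have E: "E \<in> carrier ?P"
    by (simp add: convex_lattice_def)
  have car: "carrier ?I = {C \<in> carrier ?P. x \<subseteq> C}"
    using sub by (auto simp: interval_poset_def at_least_at_most_def convex_lattice_def)
  have le: "le ?I = (\<subseteq>)" "eq ?I = (=)" "le ?P = (\<subseteq>)" "eq ?P = (=)"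
    by (simp_all add: interval_poset_def convex_lattice_def)
  have greatest_E: "greatest ?I E (carrier ?I)"
    using sub E assms by (auto simp: greatest_def car le)
  \<comment> \<open>The top of a poset is defined by choice, so it is identified through the
    uniqueness of a greatest element.\<close>
  then have "greatest ?I (\<top>\<^bsub>?I\<^esub>) (carrier ?I)"
    unfolding top_def[of ?I] by (rule someI)
  with greatest_E have top: "\<top>\<^bsub>?I\<^esub> = E"
    by (auto simp: greatest_def le)
  have less: "A \<sqsubset>\<^bsub>?I\<^esub> B \<longleftrightarrow> A \<subset> B" "A \<sqsubset>\<^bsub>?P\<^esub> B \<longleftrightarrow> A \<subset> B" for A B
    by (auto simp: lless_def le)
  have between: "(\<exists>z\<in>{C \<in> carrier ?P. x \<subseteq> C}. C \<subset> z \<and> z \<subset> E) \<longleftrightarrow>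
      (\<exists>z\<in>carrier ?P. C \<subset> z \<and> z \<subset> E)"
    if "x \<subseteq> C" for C
    using that by (metis (mono_tags, lifting) mem_Collect_eq psubset_imp_subset subset_trans)
  have "C \<in> coatoms ?I \<longleftrightarrow> C \<in> coatoms ?P \<and> x \<subseteq> C" for C
  proof (cases "x \<subseteq> C")
    case True
    then show ?thesis
      unfolding coatoms_def covered_by_def top convex_lattice_top less car mem_Collect_eq
      unfolding between[OF True]
      using E sub[OF assms] by simp
  qed (simp add: coatoms_def covered_by_def car)
  then show ?thesis
    unfolding convex_lattice_top by blast
qed

end

section \<open>Topes without zero entries on the ground set, and the coatoms of the convex
  lattice\<close>

locale nonacyclic_loopfree_oriented_matroid = oriented_matroid +
  assumes no_loops: "e \<in> E \<Longrightarrow> \<not> is_loop L e"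
    and nonacyclic: "\<not> om_acyclic E L"
begin

text \<open>Composing \<open>T\<close> with a covector that does not vanish at \<open>e\<close>
  fills a possible zero there; by maximality the composition is \<open>T\<close> again.\<close>

lemma tope_nonzero:
  assumes "T \<in> topes L" "e \<in> E"
  shows "T e \<noteq> Zero"
proof -
  obtain X where X: "X \<in> L" "X e \<noteq> Zero"
    using no_loops[OF assms(2)] by (auto simp: is_loop_def)
  have "vec_comp T X \<in> L"
    using X(1) assms(1) by (simp add: comp_covector tope_covector)
  moreover have "vec_le T (vec_comp T X)"
    by (simp add: vec_le_def vec_comp_def)
  ultimately have "vec_comp T X = T"
    using assms(1) by (simp add: topes_def)
  then show ?thesis
    using X(2) by (metis vec_comp_def)
qed

text \<open>The opposite of \<open>T\<close> vanishes nowhere on \<open>E\<close>, so a tope above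
  it has no entry left to change.\<close>

lemma tope_neg:
  assumes "T \<in> topes L"
  shows "vec_neg T \<in> topes L"
proof -
  have nz: "vec_neg T e \<noteq> Zero" if "e \<in> E" for e
    using tope_nonzero[OF assms that] by (cases "T e") (auto simp: vec_neg_def)
  obtain S where S: "S \<in> topes L" "vec_le (vec_neg T) S"
    using covector_le_tope neg_covector tope_covector assms by metis
  have "S e = vec_neg T e" for e
  proof (cases "e \<in> E")
    case True
    then show ?thesis using S(2) nz by (metis vec_le_def)
  next
    case False
    then show ?thesis
      using covector_outside tope_covector S(1) neg_covector assms by metis
  qed
  then have "S = vec_neg T" ..
  with S(1) show ?thesis by simp
qed

lemma pos_part_vec_neg:
  assumes "T \<in> topes L"
  shows "pos_part (vec_neg T) = E - pos_part T"
proof -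
  have "sign_neg (T e) = Pos \<longleftrightarrow> e \<in> E \<and> T e \<noteq> Pos" for e
    using tope_nonzero[OF assms, of e] covector_outside[OF tope_covector[OF assms], of e]
    by (cases "T e") auto
  then show ?thesis
    by (auto simp: pos_part_def vec_neg_def)
qed

lemma inj_on_pos_part: "inj_on pos_part (topes L)"
proof (rule inj_onI, rule ext)
  fix S T e assume ST: "S \<in> topes L" "T \<in> topes L" "pos_part S = pos_part T"
  then have eq: "S e = Pos \<longleftrightarrow> T e = Pos"
    by (auto simp: pos_part_def)
  show "S e = T e"
  proof (cases "e \<in> E")
    case True
    then show ?thesis
      using ST tope_nonzero eq by (cases "S e"; cases "T e") auto
  next
    case False
    then show ?thesis
      using ST tope_covector covector_outside by metis
  qed
qed

lemma pos_part_proper: "T \<in> topes L \<Longrightarrow> pos_part T \<subset> E"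
  using nonacyclic pos_part_subset[OF tope_covector] by (auto simp: om_acyclic_def pos_part_def)

text \<open>A convex set lies in the positive part of a tope, which is a proper subset of
  \<open>E\<close> in the non-acyclic case. Thus \<open>E\<close> is a new top element, and the
  coatoms are the maximal convex sets. Positive parts of topes are convex and every convex set lies
  in one of them, so the maximal elements of the two families agree.\<close>

lemma coatoms_convex_lattice: "coatoms (convex_lattice E L) = pos_part ` max_pos_topes L"
proof -
  have proper: "A \<subset> E" if A: "om_convex E L A" for A
    using convex_subset_tope[OF A] pos_part_proper by (metis subset_psubset_trans)
  have coatom: "A \<in> coatoms (convex_lattice E L) \<longleftrightarrow>
      om_convex E L A \<and> \<not> (\<exists>B. om_convex E L B \<and> A \<subset> B)" for A
  proof -
    have car: "carrier (convex_lattice E L) = insert E {A. om_convex E L A}"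
      by (simp add: convex_lattice_def)
    have less: "B \<sqsubset>\<^bsub>convex_lattice E L\<^esub> C \<longleftrightarrow> B \<subset> C" for B C
      by (auto simp: convex_lattice_def lless_def)
    have "(\<exists>B\<in>insert E {A. om_convex E L A}. A \<subset> B \<and> B \<subset> E) \<longleftrightarrow>
        (\<exists>B. om_convex E L B \<and> A \<subset> B)"
      using proper by (metis insert_iff mem_Collect_eq psubset_eq)
    then show ?thesis
      unfolding coatoms_def covered_by_def convex_lattice_top less car mem_Collect_eq
      using proper[of A] by (metis insertCI insertE mem_Collect_eq psubset_eq)
  qed
  show ?thesis
  proof (intro equalityI subsetI)
    fix A assume "A \<in> coatoms (convex_lattice E L)"
    then have A: "om_convex E L A" "\<And>B. om_convex E L B \<Longrightarrow> \<not> A \<subset> B"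
      by (auto simp: coatom)
    obtain T where "T \<in> max_pos_topes L" "A \<subseteq> pos_part T"
      using convex_subset_tope[OF A(1)] tope_subset_max_pos_tope by (metis subset_trans)
    moreover from this have "\<not> A \<subset> pos_part T"
      using A(2) tope_pos_part_convex by (auto simp: max_pos_topes_def)
    ultimately show "A \<in> pos_part ` max_pos_topes L"
      by blast
  next
    fix A assume "A \<in> pos_part ` max_pos_topes L"
    then obtain T where T: "T \<in> max_pos_topes L" "A = pos_part T"
      by blast
    have "\<not> A \<subset> B" if "om_convex E L B" for B
      using convex_subset_tope[OF that] T unfolding max_pos_topes_def
      by (metis (no_types, lifting) mem_Collect_eq psubset_subset_trans)
    then show "A \<in> coatoms (convex_lattice E L)"
      using T tope_pos_part_convex by (auto simp: coatom max_pos_topes_def)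
  qed
qed

section \<open>Negative parts of the maximal topes, the committees and the terms of the sum\<close>

definition neg_parts :: "'a set set" where
  "neg_parts = (\<lambda>T. E - pos_part T) ` max_pos_topes L"

lemma finite_neg_parts: "finite neg_parts"
  using finite_covectors by (auto simp: neg_parts_def max_pos_topes_def topes_def)

lemma empty_notin_neg_parts: "{} \<notin> neg_parts"
  using pos_part_proper by (fastforce simp: neg_parts_def max_pos_topes_def)

text \<open>A negative part is the positive part of the opposite tope. This places the sets
  \<open>D1\<close>, \<open>D2\<close> of the sum in the lattice, where their meet and join are
  taken.\<close>

lemma neg_parts_convex: "A \<in> neg_parts \<Longrightarrow> om_convex E L A"
  using tope_neg pos_part_vec_neg tope_pos_part_convex
  by (force simp: neg_parts_def max_pos_topes_def)

text \<open>This matches the index condition of the sum with \<open>neg_parts\<close>. The clause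
  \<open>A\<close> \<subseteq> \<open>E\<close> is what makes \<open>A\<close> recoverable from
  \<open>E - A\<close>.\<close>

lemma neg_parts_iff: "A \<in> neg_parts \<longleftrightarrow> A \<subseteq> E \<and> E - A \<in> coatoms (convex_lattice E L)"
proof
  assume "A \<in> neg_parts"
  then obtain T where "T \<in> max_pos_topes L" "A = E - pos_part T"
    by (auto simp: neg_parts_def)
  moreover from this have "E - A = pos_part T"
    using pos_part_proper by (auto simp: max_pos_topes_def)
  ultimately show "A \<subseteq> E \<and> E - A \<in> coatoms (convex_lattice E L)"
    by (auto simp: coatoms_convex_lattice)
next
  assume "A \<subseteq> E \<and> E - A \<in> coatoms (convex_lattice E L)"
  then show "A \<in> neg_parts"
    by (auto simp: coatoms_convex_lattice neg_parts_def)
qed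

text \<open>A majority of three topes is at least two, so for each \<open>e\<close> at most one tope
  of \<open>K\<close> may fail to be positive there. Read for two distinct topes and all
  \<open>e\<close> at once, this says that their negative parts do not meet.\<close>

lemma committee3_iff:
  assumes K: "K \<subseteq> topes L" "card K = 3"
  shows "tope_committee E L K \<longleftrightarrow> pairwise (\<lambda>S T. disjnt (E - pos_part S) (E - pos_part T)) K"
proof -
  have finK: "finite K"
    using K(2) by (intro card_ge_0_finite) simp
  have "real (card (pos_halfspace L e \<inter> K)) > 1 / 2 * real (card K) \<longleftrightarrow>
    (\<forall>S\<in>K. \<forall>T\<in>K. e \<notin> pos_part S \<and> e \<notin> pos_part T \<longrightarrow> S = T)" for e
  proof -
    let ?A = "{T \<in> K. e \<in> pos_part T}" and ?B = "{T \<in> K. e \<notin> pos_part T}"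
    have "card ?A + card ?B = card (?A \<union> ?B)"
      using finK by (intro card_Un_disjoint[symmetric]) auto
    also have "?A \<union> ?B = K" by blast
    finally have "card ?A + card ?B = 3" using K(2) by simp
    moreover have "pos_halfspace L e \<inter> K = ?A"
      using K(1) by (auto simp: pos_halfspace_def pos_part_def)
    \<comment> \<open>Since the two cardinalities add up to 3, the first exceeds 3/2 exactly when
      the second is at most 1.\<close>
    ultimately have "real (card (pos_halfspace L e \<inter> K)) > 1 / 2 * real (card K) \<longleftrightarrow>
      card ?B \<le> Suc 0"
      using K(2) by auto
    also have "\<dots> \<longleftrightarrow> (\<forall>S\<in>?B. \<forall>T\<in>?B. S = T)"
      using finK by (intro card_le_Suc0_iff_eq) auto
    finally show ?thesis by blast
  qed
  then have "tope_committee E L K \<longleftrightarrow>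
      (\<forall>e\<in>E. \<forall>S\<in>K. \<forall>T\<in>K. e \<notin> pos_part S \<and> e \<notin> pos_part T \<longrightarrow> S = T)"
    using K(1) by (simp add: tope_committee_def)
  also have "\<dots> \<longleftrightarrow> pairwise (\<lambda>S T. disjnt (E - pos_part S) (E - pos_part T)) K"
    unfolding pairwise_def disjnt_def by blast
  finally show ?thesis .
qed

text \<open>Taking negative parts is injective on topes, so it preserves both the size 3 and the
  distinctness of members, and it turns committees into disjoint triples bijectively.\<close>

lemma card_max_committees3:
  "card {K \<in> committees3 E L. K \<subseteq> max_pos_topes L} = card (disjoint_subfamilies neg_parts 3)"
proof -
  let ?f = "\<lambda>T. E - pos_part T" and ?M = "max_pos_topes L"
  have sub: "?M \<subseteq> topes L"
    by (auto simp: max_pos_topes_def)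
  have inj: "inj_on ?f ?M"
  proof (rule inj_onI)
    fix S T assume ST: "S \<in> ?M" "T \<in> ?M" "?f S = ?f T"
    then have "pos_part S = pos_part T"
      using pos_part_proper sub by blast
    then show "S = T"
      using ST sub inj_on_pos_part by (auto dest: inj_onD)
  qed
  have iff: "K \<in> committees3 E L \<longleftrightarrow> ?f ` K \<in> disjoint_subfamilies neg_parts 3"
    if "K \<subseteq> ?M" for K
  proof -
    have injK: "inj_on ?f K"
      using inj that inj_on_subset by blast
    have "pairwise disjnt (?f ` K) \<longleftrightarrow> pairwise (\<lambda>S T. disjnt (?f S) (?f T)) K"
      unfolding pairwise_def ball_simps(9)
      \<comment> \<open>Injectivity translates the condition of distinct images inside
        \<open>pairwise\<close> into distinct topes.\<close>
      by (intro ball_cong refl) (simp only: inj_on_eq_iff[OF injK])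
    then show ?thesis
      using committee3_iff[of K] that sub card_image[OF injK]
      by (auto simp: committees3_def disjoint_subfamilies_def neg_parts_def tope_committee_def)
  qed
  have "bij_betw ((`) ?f) {K \<in> committees3 E L. K \<subseteq> ?M} (disjoint_subfamilies neg_parts 3)"
    unfolding bij_betw_def
  proof
    show "inj_on ((`) ?f) {K \<in> committees3 E L. K \<subseteq> ?M}"
      using inj_on_image_Pow[OF inj] by (rule inj_on_subset) auto
    show "(`) ?f ` {K \<in> committees3 E L. K \<subseteq> ?M} = disjoint_subfamilies neg_parts 3"
    proof (intro equalityI subsetI)
      fix S assume S: "S \<in> disjoint_subfamilies neg_parts 3"
      then obtain K where "K \<subseteq> ?M" "S = ?f ` K"
        by (auto simp: disjoint_subfamilies_def neg_parts_def subset_image_iff)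
      then show "S \<in> (`) ?f ` {K \<in> committees3 E L. K \<subseteq> ?M}"
        using S iff by blast
    qed (use iff in auto)
  qed
  then show ?thesis
    by (rule bij_betw_same_card)
qed

text \<open>Convex sets are closed under intersection, so the meet of two negative parts is their
  intersection; as the bottom is the empty set, the meet condition says that they are
  disjoint.\<close>

lemma coatom_pairs_eq: "coatom_pairs E L = disjoint_subfamilies neg_parts 2"
proof -
  let ?P = "convex_lattice E L"
  interpret P: bounded_lattice ?P
    by (rule bounded_lattice_convex_lattice)
  have car: "A \<in> carrier ?P \<and> E - A \<in> coatoms ?P \<longleftrightarrow> A \<in> neg_parts" for A
    using neg_parts_iff[of A] neg_parts_convex[of A]
    by (auto simp: convex_lattice_def om_convex_def acyclic_subset_def)
  have le: "le ?P = (\<subseteq>)"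
    by (simp add: convex_lattice_def)
  have meet: "A \<sqinter>\<^bsub>?P\<^esub> B = A \<inter> B" if AB: "A \<in> neg_parts" "B \<in> neg_parts" for A B
  proof (rule antisym)
    have P: "A \<in> carrier ?P" "B \<in> carrier ?P" "A \<inter> B \<in> carrier ?P"
      using AB convex_Int neg_parts_convex by (simp_all add: convex_lattice_def)
    show "A \<sqinter>\<^bsub>?P\<^esub> B \<subseteq> A \<inter> B"
      using P.meet_left[OF P(1,2)] P.meet_right[OF P(1,2)] by (simp add: le)
    show "A \<inter> B \<subseteq> A \<sqinter>\<^bsub>?P\<^esub> B"
      using P.meet_le[OF _ _ P] by (simp add: le)
  qed
  have "A \<in> carrier ?P \<and> B \<in> carrier ?P \<and> A \<noteq> B \<and> {E - A, E - B} \<subseteq> coatoms ?P \<and>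
      A \<sqinter>\<^bsub>?P\<^esub> B = \<bottom>\<^bsub>?P\<^esub> \<longleftrightarrow>
      A \<in> neg_parts \<and> B \<in> neg_parts \<and> A \<noteq> B \<and> A \<inter> B = {}" for A B
  proof (cases "A \<in> neg_parts \<and> B \<in> neg_parts")
    case True
    then show ?thesis
      using car[of A] car[of B] by (simp add: meet convex_lattice_bottom)
  next
    case False
    then show ?thesis
      using car[of A] car[of B] by auto
  qed
  then have "coatom_pairs E L =
      {{A, B} | A B. A \<in> neg_parts \<and> B \<in> neg_parts \<and> A \<noteq> B \<and> A \<inter> B = {}}"
    unfolding coatom_pairs_def by simp
  also have "\<dots> = disjoint_subfamilies neg_parts 2"
  proof (intro equalityI subsetI)
    fix D assume "D \<in> {{A, B} | A B. A \<in> neg_parts \<and> B \<in> neg_parts \<and> A \<noteq> B \<and> A \<inter> B = {}}"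
    then obtain A B where "D = {A, B}" "A \<in> neg_parts" "B \<in> neg_parts" "A \<noteq> B" "A \<inter> B = {}"
      by blast
    then show "D \<in> disjoint_subfamilies neg_parts 2"
      by (simp add: disjoint_subfamilies_def pairwise_insert disjnt_def Int_commute)
  next
    fix D assume D: "D \<in> disjoint_subfamilies neg_parts 2"
    then obtain A B where AB: "D = {A, B}" "A \<noteq> B"
      by (auto simp: disjoint_subfamilies_def card_2_iff)
    then have "A \<in> neg_parts" "B \<in> neg_parts" "A \<inter> B = {}"
      using D by (simp_all add: disjoint_subfamilies_def pairwise_insert disjnt_def)
    then show "D \<in> {{A, B} | A B. A \<in> neg_parts \<and> B \<in> neg_parts \<and> A \<noteq> B \<and> A \<inter> B = {}}"
      using AB by blast
  qed
  finally show ?thesis .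
qed

text \<open>By the defining property of the join, a coatom \<open>C\<close> lies above it iff it
  contains both members of \<open>D\<close>, that is, iff \<open>E - C\<close> is disjoint from
  both. Complementation is therefore the bijection. If the join is \<open>E\<close>, both counts are
  0.\<close>

lemma card_coatoms_above_join:
  assumes D: "D \<in> disjoint_subfamilies neg_parts 2"
  shows "card (coatoms (interval_poset (convex_lattice E L)
      (\<Squnion>\<^bsub>convex_lattice E L\<^esub> D) (\<top>\<^bsub>convex_lattice E L\<^esub>))) =
    card {A \<in> neg_parts. \<forall>B\<in>D. disjnt A B}"
proof -
  let ?P = "convex_lattice E L"
  interpret P: bounded_lattice ?P
    by (rule bounded_lattice_convex_lattice)
  obtain A B where AB: "D = {A, B}" "A \<in> neg_parts" "B \<in> neg_parts"
    using D by (auto simp: disjoint_subfamilies_def card_2_iff)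
  have car: "A \<in> carrier ?P" "B \<in> carrier ?P"
    using AB neg_parts_convex by (auto simp: convex_lattice_def)
  have le: "le ?P = (\<subseteq>)"
    by (simp add: convex_lattice_def)
  have join: "\<Squnion>\<^bsub>?P\<^esub> D = A \<squnion>\<^bsub>?P\<^esub> B"
    by (simp add: AB(1) join_def)
  have above: "\<Squnion>\<^bsub>?P\<^esub> D \<subseteq> C \<longleftrightarrow> A \<subseteq> C \<and> B \<subseteq> C" if C: "C \<in> carrier ?P" for C
    using P.join_le[of A C B] P.join_left[of A B] P.join_right[of A B] car C
    unfolding join le by blast
  have coatom: "C \<in> carrier ?P \<and> C \<subseteq> E" if "C \<in> coatoms ?P" for C
    using that
    by (auto simp: coatoms_def covered_by_def convex_lattice_def om_convex_def acyclic_subset_def)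
  have "bij_betw (\<lambda>C. E - C) {C \<in> coatoms ?P. \<Squnion>\<^bsub>?P\<^esub> D \<subseteq> C} {A \<in> neg_parts. \<forall>B\<in>D. disjnt A B}"
  proof (rule bij_betw_byWitness[where f' = "\<lambda>C. E - C"])
    show "(\<lambda>C. E - C) ` {C \<in> coatoms ?P. \<Squnion>\<^bsub>?P\<^esub> D \<subseteq> C} \<subseteq> {A \<in> neg_parts. \<forall>B\<in>D. disjnt A B}"
      using above coatom by (auto simp: neg_parts_iff double_diff AB(1) disjnt_def)
    show "(\<lambda>C. E - C) ` {A \<in> neg_parts. \<forall>B\<in>D. disjnt A B} \<subseteq> {C \<in> coatoms ?P. \<Squnion>\<^bsub>?P\<^esub> D \<subseteq> C}"
    proof (rule image_subsetI)
      fix C assume "C \<in> {A \<in> neg_parts. \<forall>B\<in>D. disjnt A B}"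
      then have C: "E - C \<in> coatoms ?P" "disjnt C A" "disjnt C B"
        by (auto simp: neg_parts_iff AB(1))
      then have "A \<subseteq> E - C" "B \<subseteq> E - C"
        using AB(2,3) by (auto simp: neg_parts_iff disjnt_def)
      then show "E - C \<in> {C \<in> coatoms ?P. \<Squnion>\<^bsub>?P\<^esub> D \<subseteq> C}"
        using C(1) above coatom by simp
    qed
  qed (use coatom neg_parts_iff in auto)
  then show ?thesis
    using coatoms_interval[of "\<Squnion>\<^bsub>?P\<^esub> D"] car join by (simp add: bij_betw_same_card)
qed

end

theorem proposition3p1:
  fixes E :: "'a set" and L :: "'a sign_vec set"
  assumes "oriented_matroid E L"
    and "om_simple E L"
    and "\<not> om_acyclic E L"
  shows "real (card {K \<in> committees3 E L. K \<subseteq> max_pos_topes L}) =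
    1 / 3 * (\<Sum>D \<in> coatom_pairs E L.
      real (card (coatoms (interval_poset (convex_lattice E L)
        (\<Squnion>\<^bsub>convex_lattice E L\<^esub> D) (\<top>\<^bsub>convex_lattice E L\<^esub>)))))"
proof -
  interpret oriented_matroid E L by fact
  interpret nonacyclic_loopfree_oriented_matroid E L
    using assms(2,3) by unfold_locales (auto simp: om_simple_def)
  let ?N = neg_parts
  \<comment> \<open>The identity is proved in the natural numbers without division; the factor 1/3
    appears only on passing to the reals.\<close>
  have "(\<Sum>D \<in> coatom_pairs E L. card (coatoms (interval_poset (convex_lattice E L)
        (\<Squnion>\<^bsub>convex_lattice E L\<^esub> D) (\<top>\<^bsub>convex_lattice E L\<^esub>)))) =
      (\<Sum>D \<in> disjoint_subfamilies ?N 2. card {S \<in> disjoint_subfamilies ?N (Suc 2). D \<subseteq> S})"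
    unfolding coatom_pairs_eq
  proof (rule sum.cong[OF refl])
    fix D assume D: "D \<in> disjoint_subfamilies ?N 2"
    then show "card (coatoms (interval_poset (convex_lattice E L)
        (\<Squnion>\<^bsub>convex_lattice E L\<^esub> D) (\<top>\<^bsub>convex_lattice E L\<^esub>))) =
      card {S \<in> disjoint_subfamilies ?N (Suc 2). D \<subseteq> S}"
      using card_coatoms_above_join[OF D]
        card_one_step_extensions[OF D finite_neg_parts empty_notin_neg_parts] by simp
  qed
  \<comment> \<open>The factor 3 is the number of pairs inside a triple.\<close>
  also have "\<dots> = (Suc 2 choose 2) * card (disjoint_subfamilies ?N (Suc 2))"
    by (rule sum_extensions_disjoint_subfamilies[OF finite_neg_parts])
  also have "\<dots> = 3 * card {K \<in> committees3 E L. K \<subseteq> max_pos_topes L}"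
    by (simp add: card_max_committees3 numeral_3_eq_3 numeral_2_eq_2)
  finally show ?thesis
    by (simp flip: of_nat_sum)
qed

end
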